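(* $\mathcal{R}_q^{-}$ is freely generated as a $\mathbb{Z}[q^{-1}]$-module by $\overline{\genfrac{[}{]}{0pt}{}{x}{k}}$ for $k\in\mathbb{N}$. For $i,j\in\mathbb{N}$ these basis elements multiply as $$\overline{\genfrac{[}{]}{0pt}{}{x}{i}}\;\overline{\genfrac{[}{]}{0pt}{}{x}{j}}=\sum_{k=\max(i,j)}^{i+j}\frac{q^{i(i-k)+j(j-k)}\,[k]_q!}{[k-i]_q!\,[k-j]_q!\,[i+j-k]_q!}\;\overline{\genfrac{[}{]}{0pt}{}{x}{k}}.$$ In particular, the $\mathbb{Z}[q^{-1}]$-algebra $\mathcal{R}_q^{-}$ with distinguished basis $\left\{\overline{\genfrac{[}{]}{0pt}{}{x}{k}} : k\in\mathbb{N}\right\}$ has structure constants in $\mathbb{N}[q^{-1}]$.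
   Context: Here $q$ and $x$ are commuting indeterminates, $\mathbb{N}=\{0,1,2,\dots\}$. For $n\in\mathbb{Z}$, $[n]_q:=(q^n-1)/(q-1)\in\mathbb{Z}[q,q^{-1}]$; for $n\in\mathbb{N}$, $[n]_q!:=[n]_q\cdots[1]_q$ with $[0]_q!:=1$. $\mathcal{R}_q^{-}:=\{P(x)\in\mathbb{Q}(q)[x] : P([-n]_q)\in\mathbb{Z}[q^{-1}]\text{ for all }n\in\mathbb{N}\}$. The $q$-binomial coefficient polynomials are $\genfrac{[}{]}{0pt}{}{x}{k}:=\frac{x(x-[1]_q)\cdots(x-[k-1]_q)}{q^{\binom{k}{2}}[k]_q!}$ for $k\ge1$ and $\genfrac{[}{]}{0pt}{}{x}{0}:=1$. The bar involution $P\mapsto\overline{P}$ is the ring involution of $\mathbb{Q}(q)[x]$ determined by $\overline{q}=q^{-1}$ (extended to the field involution of $\mathbb{Q}(q)$) and $\overline{x}=-qx$. $\mathbb{N}[q^{-1}]$ denotes polynomials in $q^{-1}$ with coefficients in $\mathbb{N}$. *)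

theory Defs
  imports
    "HOL-Computational_Algebra.Polynomial_Factorial"
    "HOL-Computational_Algebra.Field_as_Ring"
    "HOL-Algebra.Module"
begin

text \<open>
  The field \<open>\<rat>(q)\<close> is \<^typ>\<open>rat poly fract\<close>, and \<open>\<rat>(q)[x]\<close> is \<^typ>\<open>rat poly fract poly\<close>.
  The name \<open>smult\<close> is ambiguous below: \<open>Polynomial.smult\<close> is scaling of a polynomial,
  \<open>module.smult\<close> (written \<open>\<odot>\<close>) is the field of the HOL-Algebra record.
\<close>

type_synonym ratq = "rat poly fract"

definition q :: ratq where
  "q = to_fract [:0, 1:]"

definition qint :: "int \<Rightarrow> ratq" where
  "qint n = (q powi n - 1) / (q - 1)"

definition qfact :: "nat \<Rightarrow> ratq" where
  "qfact n = (\<Prod>i=1..n. qint (int i))"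

text \<open>\<open>\<int>[q\<^sup>-\<^sup>1]\<close> and \<open>\<nat>[q\<^sup>-\<^sup>1]\<close> as subsets of \<open>\<rat>(q)\<close>.\<close>

definition Z_qinv :: "ratq set" where
  "Z_qinv = range (\<lambda>p :: int poly. poly (map_poly of_int p) (inverse q))"

definition N_qinv :: "ratq set" where
  "N_qinv = range (\<lambda>p :: nat poly. poly (map_poly of_nat p) (inverse q))"

definition Rq_minus :: "ratq poly set" where
  "Rq_minus = {P. \<forall>n::nat. poly P (qint (- int n)) \<in> Z_qinv}"

text \<open>For \<open>k = 0\<close> the product is empty and this is \<open>1\<close>; for \<open>k \<ge> 1\<close> the factor \<open>i = 0\<close> is \<open>x\<close>,
  since \<open>qint 0 = 0\<close>.\<close>

definition qbinom :: "nat \<Rightarrow> ratq poly" where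
  "qbinom k = Polynomial.smult (inverse (q ^ (k choose 2) * qfact k)) (\<Prod>i<k. [:- qint (int i), 1:])"


subsection \<open>The bar involution\<close>

definition subst_qinv :: "rat poly \<Rightarrow> ratq" where
  "subst_qinv a = poly (map_poly (\<lambda>c. to_fract [:c:]) a) (inverse q)"

definition bar_coeff :: "ratq \<Rightarrow> ratq" where
  "bar_coeff f = (case quot_of_fract f of (a, b) \<Rightarrow> subst_qinv a / subst_qinv b)"

definition bar :: "ratq poly \<Rightarrow> ratq poly" where
  "bar P = map_poly bar_coeff P \<circ>\<^sub>p [:0, - q:]"

text \<open>The facts in this subsection confirm that \<^const>\<open>bar\<close> is the ring involution of
  \<open>\<rat>(q)[x]\<close> with \<open>q \<mapsto> q\<^sup>-\<^sup>1\<close> and \<open>x \<mapsto> - q x\<close>.\<close>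

lemma q_nonzero [simp]: "q \<noteq> 0"
  by (simp add: q_def)

lemma map_poly_hom_add:
  fixes h :: "'a::comm_ring_1 \<Rightarrow> 'b::comm_ring_1"
  assumes "h 0 = 0" "\<And>x y. h (x + y) = h x + h y"
  shows "map_poly h (a + b) = map_poly h a + map_poly h b"
  by (rule poly_eqI) (simp add: coeff_map_poly assms)

lemma map_poly_hom_mult:
  fixes h :: "'a::comm_ring_1 \<Rightarrow> 'b::comm_ring_1"
  assumes h0: "h 0 = 0" and ha: "\<And>x y. h (x + y) = h x + h y"
    and hm: "\<And>x y. h (x * y) = h x * h y"
  shows "map_poly h (a * b) = map_poly h a * map_poly h b"
proof (induction a)
  case 0
  then show ?case by simp
next
  case (pCons c a)
  have s: "map_poly h (Polynomial.smult c b) = Polynomial.smult (h c) (map_poly h b)"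
    by (rule poly_eqI) (simp add: coeff_map_poly h0 hm)
  have p: "map_poly h (pCons c' r) = pCons (h c') (map_poly h r)" for c' r
    by (rule poly_eqI) (simp add: coeff_map_poly h0 coeff_pCons split: nat.splits)
  show ?case
    by (simp add: p s pCons.IH map_poly_hom_add[of h, OF h0 ha] h0)
qed

lemma subst_qinv_add: "subst_qinv (a + b) = subst_qinv a + subst_qinv b"
  unfolding subst_qinv_def
  by (subst map_poly_hom_add) (simp_all flip: to_fract_add)

lemma subst_qinv_mult: "subst_qinv (a * b) = subst_qinv a * subst_qinv b"
  unfolding subst_qinv_def
  by (subst map_poly_hom_mult) (simp_all flip: to_fract_add to_fract_mult)

lemma subst_qinv_const: "subst_qinv [:c:] = to_fract [:c:]"
  by (simp add: subst_qinv_def map_poly_pCons)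

lemma subst_qinv_1: "subst_qinv 1 = 1"
  using subst_qinv_const[of 1] by (simp flip: one_pCons)

lemma poly_q_eq_to_fract: "poly (map_poly (\<lambda>c. to_fract [:c:]) a) q = to_fract a"
proof (induction a)
  case (pCons c a)
  have "to_fract (pCons c a) = to_fract ([:c:] + [:0, 1:] * a)" by simp
  also have "\<dots> = to_fract [:c:] + q * to_fract a"
    by (simp only: to_fract_add to_fract_mult q_def)
  finally show ?case using pCons by (simp add: map_poly_pCons)
qed simp

lemma subst_qinv_nonzero:
  assumes "a \<noteq> 0" shows "subst_qinv a \<noteq> 0"
proof
  let ?e = "\<lambda>c::rat. to_fract [:c:]"
  assume "subst_qinv a = 0"
  then have "poly (reflect_poly (map_poly ?e a)) q = 0"
    by (simp add: poly_reflect_poly_nz subst_qinv_def)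
  moreover have "reflect_poly (map_poly ?e a) = map_poly ?e (reflect_poly a)"
    by (rule poly_eqI) (simp add: coeff_map_poly coeff_reflect_poly degree_map_poly)
  ultimately show False using assms by (simp add: poly_q_eq_to_fract)
qed

lemma bar_coeff_Fract:
  assumes "b \<noteq> 0" shows "bar_coeff (Fract a b) = subst_qinv a / subst_qinv b"
proof -
  obtain c d where cd: "quot_of_fract (Fract a b) = (c, d)" by force
  have d: "d \<noteq> 0" using snd_quot_of_fract_nonzero[of "Fract a b"] cd by simp
  have "Fract c d = Fract a b" using Fract_quot_of_fract[of "Fract a b"] cd by simp
  then have "c * b = a * d" using assms d by (simp add: eq_fract)
  then have "subst_qinv c * subst_qinv b = subst_qinv a * subst_qinv d"
    by (simp flip: subst_qinv_mult)
  then show ?thesis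
    by (simp add: bar_coeff_def cd frac_eq_eq subst_qinv_nonzero assms d)
qed

lemma bar_coeff_to_fract: "bar_coeff (to_fract a) = subst_qinv a"
  using bar_coeff_Fract[of 1 a] by (simp add: to_fract_def subst_qinv_1)

lemma bar_coeff_0: "bar_coeff 0 = 0"
  using bar_coeff_to_fract[of 0] by (simp add: subst_qinv_def)

lemma bar_coeff_1: "bar_coeff 1 = 1"
  using bar_coeff_to_fract[of 1] by (simp add: subst_qinv_1)

lemma bar_coeff_add: "bar_coeff (f + g) = bar_coeff f + bar_coeff g"
proof (cases f; cases g)
  fix a b c d :: "rat poly"
  assume "f = Fract a b" "b \<noteq> 0" "g = Fract c d" "d \<noteq> 0"
  then show ?thesis
    by (simp add: bar_coeff_Fract subst_qinv_add subst_qinv_mult subst_qinv_nonzero field_simps)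
qed

lemma bar_coeff_mult: "bar_coeff (f * g) = bar_coeff f * bar_coeff g"
proof (cases f; cases g)
  fix a b c d :: "rat poly"
  assume "f = Fract a b" "b \<noteq> 0" "g = Fract c d" "d \<noteq> 0"
  then show ?thesis
    by (simp add: bar_coeff_Fract subst_qinv_mult)
qed

lemma bar_coeff_q: "bar_coeff q = inverse q"
  by (simp add: q_def bar_coeff_to_fract subst_qinv_def map_poly_pCons
      flip: One_fract_def one_pCons)

lemma bar_coeff_inverse: "bar_coeff (inverse f) = inverse (bar_coeff f)"
proof (cases "f = 0")
  case False
  then have "bar_coeff f * bar_coeff (inverse f) = 1"
    by (simp flip: bar_coeff_mult add: bar_coeff_1)
  then show ?thesis by (metis inverse_unique)
qed (simp add: bar_coeff_0)

lemma bar_coeff_subst_qinv: "bar_coeff (subst_qinv a) = to_fract a"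
proof -
  have "bar_coeff (poly (map_poly (\<lambda>c. to_fract [:c:]) a) (inverse q))
      = poly (map_poly (\<lambda>c. to_fract [:c:]) a) q"
    by (induction a)
      (simp_all add: map_poly_pCons bar_coeff_0 bar_coeff_add bar_coeff_mult bar_coeff_inverse
        bar_coeff_q bar_coeff_to_fract subst_qinv_const)
  then show ?thesis by (simp add: subst_qinv_def poly_q_eq_to_fract)
qed

lemma bar_coeff_bar_coeff: "bar_coeff (bar_coeff f) = f"
proof (cases f)
  case (Fract a b)
  then show ?thesis
    by (simp add: bar_coeff_to_fract divide_inverse bar_coeff_mult bar_coeff_inverse
        bar_coeff_subst_qinv Fract_conv_to_fract)
qed

lemma bar_add: "bar (P + Q) = bar P + bar Q"
  by (simp add: bar_def map_poly_hom_add bar_coeff_0 bar_coeff_add pcompose_add)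

lemma bar_mult: "bar (P * Q) = bar P * bar Q"
  by (simp add: bar_def map_poly_hom_mult bar_coeff_0 bar_coeff_add bar_coeff_mult pcompose_mult)

lemma bar_const: "bar [:f:] = [:bar_coeff f:]"
  by (simp add: bar_def map_poly_pCons bar_coeff_0)

lemma bar_1: "bar 1 = 1"
  by (simp add: bar_const bar_coeff_1 one_pCons)

lemma bar_q: "bar [:q:] = [:inverse q:]"
  by (simp add: bar_const bar_coeff_q)

lemma bar_x: "bar [:0, 1:] = [:0, - q:]"
  by (simp add: bar_def map_poly_pCons bar_coeff_0 bar_coeff_1 pcompose_pCons)

lemma bar_coeff_uminus: "bar_coeff (- f) = - bar_coeff f"
  using bar_coeff_add[of f "- f"] by (simp add: bar_coeff_0 eq_neg_iff_add_eq_0 add.commute)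

lemma bar_bar: "bar (bar P) = P"
proof (induction P)
  case 0
  then show ?case by (simp add: bar_def)
next
  case (pCons c P)
  have x: "bar [:0, - q:] = [:0, 1:]"
    by (simp add: bar_def map_poly_pCons bar_coeff_0 bar_coeff_uminus bar_coeff_q pcompose_pCons)
  have "pCons c P = [:c:] + [:0, 1:] * P" by simp
  then show ?case
    using pCons.IH by (simp only: bar_add bar_mult bar_const bar_coeff_bar_coeff bar_x x)
qed


subsection \<open>Free generation and structure constants\<close>

definition is_expansion ::
    "('a, 'm) ring_scheme \<Rightarrow> ('a, 'b, 'n) module_scheme \<Rightarrow> ('i \<Rightarrow> 'b) \<Rightarrow> 'b \<Rightarrow> ('i \<Rightarrow> 'a) \<Rightarrow> bool" where
  "is_expansion R M b m c \<longleftrightarrow>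
     range c \<subseteq> carrier R \<and> finite {i. c i \<noteq> \<zero>\<^bsub>R\<^esub>} \<and>
     m = (\<Oplus>\<^bsub>M\<^esub>i\<in>{i. c i \<noteq> \<zero>\<^bsub>R\<^esub>}. c i \<odot>\<^bsub>M\<^esub> b i)"

definition freely_generated ::
    "('a, 'm) ring_scheme \<Rightarrow> ('a, 'b, 'n) module_scheme \<Rightarrow> ('i \<Rightarrow> 'b) \<Rightarrow> bool" where
  "freely_generated R M b \<longleftrightarrow>
     Module.module R M \<and> range b \<subseteq> carrier M \<and> (\<forall>m \<in> carrier M. \<exists>!c. is_expansion R M b m c)"

text \<open>Only meaningful when \<open>b\<close> freely generates \<open>A\<close>: the coefficient of \<open>b k\<close> in \<open>b i \<otimes> b j\<close>.\<close>

definition structure_constant ::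
    "('a, 'm) ring_scheme \<Rightarrow> ('a, 'b, 'n) module_scheme \<Rightarrow> ('i \<Rightarrow> 'b) \<Rightarrow> 'i \<Rightarrow> 'i \<Rightarrow> 'i \<Rightarrow> 'a" where
  "structure_constant R A b i j k = (THE c. is_expansion R A b (b i \<otimes>\<^bsub>A\<^esub> b j) c) k"

definition Z_qinv_ring :: "ratq ring" where
  "Z_qinv_ring = \<lparr>carrier = Z_qinv, mult = (*), one = 1, zero = 0, add = (+)\<rparr>"

definition Rq_minus_algebra :: "(ratq, ratq poly) module" where
  "Rq_minus_algebra = \<lparr>carrier = Rq_minus, mult = (*), one = 1, zero = 0, add = (+),
     smult = Polynomial.smult\<rparr>"

end

theory Submission
  imports Defs
begin

text \<open>
  Write \<open>p = q\<^sup>-\<^sup>1\<close>, \<open>[n]\<^sub>p = 1 + p + \<dots> + p\<^bsup>n-1\<^esup>\<close>, and let \<open>\<beta> k\<close> be the bar image of the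
  \<open>k\<close>-th \<open>q\<close>-binomial polynomial. The bar involution sends \<open>[k]\<^sub>q\<close> to \<open>[k]\<^sub>p\<close> and \<open>x\<close> to \<open>- q x\<close>, so
  the \<open>\<beta> k\<close> satisfy the first-order recursion (\<open>barbinom_Suc\<close>)
  \<open>(- q x - [k]\<^sub>p) \<beta> k = p\<^sup>k [k+1]\<^sub>p \<beta> (k+1)\<close>, and \<open>- q [-n]\<^sub>q = [n]\<^sub>p\<close>. Gaussian binomial coefficients
  in \<open>p\<close> obey the same recursion in their lower index, whence \<open>\<beta> k\<close> takes at \<open>[-n]\<^sub>q\<close> the value
  \<open>(n over k)\<^sub>p\<close> (\<open>poly_barbinom\<close>). These values lie in \<open>\<nat>[p]\<close>, vanish for \<open>k > n\<close> and equal \<open>1\<close>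
  for \<open>k = n\<close>.

  Free generation follows from this unitriangularity. The recursion expresses \<open>x \<beta> k\<close> through
  \<open>\<beta> k\<close> and \<open>\<beta> (k+1)\<close>, so the \<open>\<beta> k\<close> span \<open>\<rat>(q)[x]\<close> over \<open>\<rat>(q)\<close> (\<open>poly_eq_sum_barbinom\<close>). The
  coordinates of \<open>P\<close> are the solution of a unitriangular system over \<open>\<int>[p]\<close> whose right-hand side
  is the sequence of values \<open>P([-n]\<^sub>q)\<close> (\<open>coeff_eq_triangular\<close>); hence they are unique, and they
  lie in \<open>\<int>[p]\<close> as soon as the values do.

  The product formula is an induction on \<open>i\<close> (\<open>barbinom_mult\<close>). Multiplying the expansion of
  \<open>\<beta> i \<beta> j\<close> by \<open>- q x - [i]\<^sub>p = (- q x - [k]\<^sub>p) + ([k]\<^sub>p - [i]\<^sub>p)\<close> turns it into that of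
  \<open>\<beta> (i+1) \<beta> j\<close>, and the resulting recursion for the coefficients is solved by
  \<open>p\<^bsup>(k-i)(k-j)\<^esup> (k over i)\<^sub>p (i over k-j)\<^sub>p\<close>, where it reduces to Pascal's rule. In this shape
  the coefficients visibly lie in \<open>\<nat>[p]\<close>; the quotient of \<open>q\<close>-factorials in the theorem is the same
  element because \<open>[n]\<^sub>q! = q\<^bsup>n(n-1)/2\<^esup> [n]\<^sub>p!\<close> (\<open>binom_prod_coeff_eq\<close>).
\<close>

section \<open>Gaussian binomial coefficients\<close>

definition qnum :: "'a::comm_semiring_1 \<Rightarrow> nat \<Rightarrow> 'a" where
  "qnum p n = (\<Sum>i<n. p ^ i)"

definition qnum_fact :: "'a::comm_semiring_1 \<Rightarrow> nat \<Rightarrow> 'a" where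
  "qnum_fact p n = (\<Prod>i=1..n. qnum p i)"

text \<open>
  Pascal's rule as the definition makes sense in any commutative semiring and shows at once
  that the coefficients are polynomials in \<open>p\<close> with natural coefficients.
\<close>

fun gauss_binom :: "'a::comm_semiring_1 \<Rightarrow> nat \<Rightarrow> nat \<Rightarrow> 'a" where
  "gauss_binom p n 0 = 1"
| "gauss_binom p 0 (Suc k) = 0"
| "gauss_binom p (Suc n) (Suc k) = gauss_binom p n k + p ^ Suc k * gauss_binom p n (Suc k)"

lemma qnum_0 [simp]: "qnum p 0 = 0"
  by (simp add: qnum_def)

lemma qnum_Suc: "qnum p (Suc n) = qnum p n + p ^ n"
  by (simp add: qnum_def)

lemma qnum_Suc_shift: "qnum p (Suc n) = 1 + p * qnum p n"
  by (simp add: qnum_def sum.lessThan_Suc_shift sum_distrib_left del: sum.lessThan_Suc)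

lemma qnum_geometric:
  fixes p :: "'a::comm_ring_1"
  shows "(p - 1) * qnum p n = p ^ n - 1"
  by (induction n) (simp_all add: qnum_Suc algebra_simps)

lemma qnum_fact_0 [simp]: "qnum_fact p 0 = 1"
  by (simp add: qnum_fact_def)

lemma qnum_fact_Suc: "qnum_fact p (Suc n) = qnum p (Suc n) * qnum_fact p n"
  by (simp add: qnum_fact_def mult.commute)

lemma gauss_binom_eq_0: "n < k \<Longrightarrow> gauss_binom p n k = 0"
  by (induction p n k rule: gauss_binom.induct) auto

lemma gauss_binom_self: "gauss_binom p n n = 1"
  by (induction n) (auto simp: gauss_binom_eq_0)

text \<open>
  The recursion of the Gaussian coefficients in the lower index. The factor
  \<open>p\<^sup>k [n-k]\<^sub>p\<close> is written as \<open>[n]\<^sub>p - [k]\<^sub>p\<close> so that no case \<open>n < k\<close> has to be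
  separated, and the factor \<open>[k+1]\<^sub>p\<close> stays on the left so that no division occurs.
\<close>

lemma gauss_binom_ratio:
  fixes p :: "'a::comm_ring_1"
  shows "p ^ k * qnum p (Suc k) * gauss_binom p n (Suc k) = (qnum p n - qnum p k) * gauss_binom p n k"
proof (induction n arbitrary: k)
  case 0
  then show ?case by (cases k) auto
next
  case (Suc n)
  show ?case
  proof (cases k)
    case 0
    have "gauss_binom p n (Suc 0) = qnum p n" using Suc[of 0] by (simp add: qnum_Suc)
    then show ?thesis using 0 by (simp add: qnum_Suc_shift)
  next
    case (Suc l)
    let ?G = "gauss_binom p n"
    have 1: "p ^ l * qnum p (Suc l) * ?G (Suc l) = (qnum p n - qnum p l) * ?G l"
      and 2: "p ^ Suc l * qnum p (Suc (Suc l)) * ?G (Suc (Suc l))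
        = (qnum p n - qnum p (Suc l)) * ?G (Suc l)"
      by (rule Suc.IH)+
    have "p ^ Suc l * qnum p (Suc (Suc l)) * gauss_binom p (Suc n) (Suc (Suc l))
        = p ^ Suc l * qnum p (Suc (Suc l)) * ?G (Suc l)
          + p ^ Suc (Suc l) * (p ^ Suc l * qnum p (Suc (Suc l)) * ?G (Suc (Suc l)))"
      by (simp add: algebra_simps)
    also have "\<dots> = p ^ Suc l * (1 + p * qnum p n) * ?G (Suc l)"
      by (simp only: 2) (simp add: qnum_Suc_shift algebra_simps)
    also have "\<dots> = p * (p ^ l * qnum p (Suc l) * ?G (Suc l))
          + (qnum p (Suc n) - qnum p (Suc l)) * p ^ Suc l * ?G (Suc l)"
      by (simp only: qnum_Suc_shift[of p n]) (simp add: algebra_simps)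
    also have "\<dots> = (qnum p (Suc n) - qnum p (Suc l)) * gauss_binom p (Suc n) (Suc l)"
      by (simp only: 1) (simp add: qnum_Suc_shift algebra_simps)
    finally show ?thesis using Suc by simp
  qed
qed

lemma gauss_binom_absorb:
  fixes p :: "'a::comm_ring_1"
  shows "qnum p (Suc k) * gauss_binom p (Suc n) (Suc k) = qnum p (Suc n) * gauss_binom p n k"
proof -
  have "qnum p (Suc k) * gauss_binom p (Suc n) (Suc k)
      = qnum p (Suc k) * gauss_binom p n k + p * (p ^ k * qnum p (Suc k) * gauss_binom p n (Suc k))"
    by (simp add: algebra_simps)
  also have "\<dots> = qnum p (Suc n) * gauss_binom p n k"
    by (simp only: gauss_binom_ratio) (simp add: qnum_Suc_shift algebra_simps)
  finally show ?thesis .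
qed

lemma gauss_binom_fact:
  fixes p :: "'a::comm_ring_1"
  shows "gauss_binom p (a + b) a * qnum_fact p a * qnum_fact p b = qnum_fact p (a + b)"
proof (induction a)
  case (Suc a)
  have "gauss_binom p (Suc a + b) (Suc a) * qnum_fact p (Suc a) * qnum_fact p b
      = (qnum p (Suc a) * gauss_binom p (Suc (a + b)) (Suc a)) * qnum_fact p a * qnum_fact p b"
    by (simp only: qnum_fact_Suc add_Suc mult_ac)
  also have "\<dots> = qnum p (Suc (a + b)) * (gauss_binom p (a + b) a * qnum_fact p a * qnum_fact p b)"
    by (simp only: gauss_binom_absorb mult_ac)
  finally show ?case by (simp add: Suc qnum_fact_Suc)
qed simp

text \<open>
  The coefficient of \<open>\<beta> (j + b)\<close> in \<open>\<beta> i \<beta> j\<close>. Indexing by \<open>b = k - j \<le> i\<close> removes the lower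
  bound \<open>max i j\<close> of the summation: for \<open>j + b < i\<close>, where the exponent is truncated, the first
  Gaussian coefficient is \<open>0\<close>.
\<close>

definition binom_prod_coeff :: "'a::comm_semiring_1 \<Rightarrow> nat \<Rightarrow> nat \<Rightarrow> nat \<Rightarrow> 'a" where
  "binom_prod_coeff p i j b = p ^ ((j + b - i) * b) * gauss_binom p (j + b) i * gauss_binom p i b"

text \<open>
  This lemma and the next are the comparison of coefficients in the induction step of the
  product formula; \<open>b = 0\<close> is separate because the term shifted up from \<open>b - 1\<close> is then absent.
\<close>

lemma binom_prod_coeff_Suc_0:
  fixes p :: "'a::comm_ring_1"
  shows "p ^ i * qnum p (Suc i) * binom_prod_coeff p (Suc i) j 0
    = binom_prod_coeff p i j 0 * (qnum p j - qnum p i)"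
  using gauss_binom_ratio[of p i j] by (simp add: binom_prod_coeff_def mult_ac)

text \<open>
  With \<open>n = j + b\<close>, the ratio and absorption rules make \<open>[i+1]\<^sub>p (n+1 over i+1)\<^sub>p\<close> (called \<open>W\<close>
  below) a common factor of all three terms. What remains after cancelling powers of \<open>p\<close> is
  Pascal's rule for \<open>(i+1 over b+1)\<^sub>p\<close>.
\<close>

lemma binom_prod_coeff_Suc_Suc:
  fixes p :: "'a::comm_ring_1"
  shows "p ^ i * qnum p (Suc i) * binom_prod_coeff p (Suc i) j (Suc b)
    = binom_prod_coeff p i j b * (p ^ (j + b) * qnum p (Suc (j + b)))
      + binom_prod_coeff p i j (Suc b) * (qnum p (Suc (j + b)) - qnum p i)"
proof -
  define n where "n = j + b"
  define W where "W = qnum p (Suc i) * gauss_binom p (Suc n) (Suc i)"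
  have W1: "gauss_binom p n i * qnum p (Suc n) = W"
    by (simp only: W_def gauss_binom_absorb mult.commute)
  have W2: "gauss_binom p (Suc n) i * (qnum p (Suc n) - qnum p i) = p ^ i * W"
    using gauss_binom_ratio[of p i "Suc n"] by (simp only: W_def mult_ac)
  have L: "p ^ i * qnum p (Suc i) * binom_prod_coeff p (Suc i) j (Suc b)
      = p ^ (i + (n - i) * Suc b) * W * gauss_binom p (Suc i) (Suc b)"
    by (simp add: binom_prod_coeff_def W_def n_def power_add mult_ac del: gauss_binom.simps)
  have R: "binom_prod_coeff p i j b * (p ^ n * qnum p (Suc n))
      + binom_prod_coeff p i j (Suc b) * (qnum p (Suc n) - qnum p i)
    = p ^ ((n - i) * b + n) * gauss_binom p i b * (gauss_binom p n i * qnum p (Suc n))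
      + p ^ ((Suc n - i) * Suc b) * gauss_binom p i (Suc b) *
        (gauss_binom p (Suc n) i * (qnum p (Suc n) - qnum p i))"
    by (simp add: binom_prod_coeff_def n_def power_add mult_ac del: gauss_binom.simps)
  show ?thesis
  proof (cases "i \<le> n")
    case True
    then obtain m where m: "n = i + m" using le_Suc_ex by blast
    show ?thesis
      unfolding L n_def[symmetric] R W1 W2
      by (simp add: m algebra_simps power_add Suc_diff_le)
  next
    case False
    then have "W = 0" by (simp add: W_def gauss_binom_eq_0 del: gauss_binom.simps)
    then show ?thesis
      unfolding L n_def[symmetric] R W1 W2 by simp
  qed
qed

section \<open>The rings \<open>\<int>[q\<^sup>-\<^sup>1]\<close> and \<open>\<nat>[q\<^sup>-\<^sup>1]\<close>\<close>

lemma map_poly_of_int_add: "map_poly of_int (f + g) = map_poly of_int f + map_poly of_int g"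
  by (rule poly_eqI) (simp add: coeff_map_poly)

lemma map_poly_of_int_mult:
  "(map_poly of_int (f * g) :: 'a::comm_ring_1 poly) = map_poly of_int f * map_poly of_int g"
  by (rule poly_eqI) (simp add: coeff_map_poly coeff_mult)

lemma map_poly_of_nat_add: "map_poly of_nat (f + g) = map_poly of_nat f + map_poly of_nat g"
  by (rule poly_eqI) (simp add: coeff_map_poly)

lemma map_poly_of_nat_mult:
  "(map_poly of_nat (f * g) :: 'a::comm_semiring_1 poly) = map_poly of_nat f * map_poly of_nat g"
  by (rule poly_eqI) (simp add: coeff_map_poly coeff_mult)

lemma Z_qinv_add: "a \<in> Z_qinv \<Longrightarrow> b \<in> Z_qinv \<Longrightarrow> a + b \<in> Z_qinv"
  unfolding Z_qinv_def by (auto simp flip: poly_add map_poly_of_int_add)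

lemma Z_qinv_mult: "a \<in> Z_qinv \<Longrightarrow> b \<in> Z_qinv \<Longrightarrow> a * b \<in> Z_qinv"
  unfolding Z_qinv_def by (auto simp flip: poly_mult map_poly_of_int_mult)

lemma N_qinv_add: "a \<in> N_qinv \<Longrightarrow> b \<in> N_qinv \<Longrightarrow> a + b \<in> N_qinv"
  unfolding N_qinv_def by (auto simp flip: poly_add map_poly_of_nat_add)

lemma N_qinv_mult: "a \<in> N_qinv \<Longrightarrow> b \<in> N_qinv \<Longrightarrow> a * b \<in> N_qinv"
  unfolding N_qinv_def by (auto simp flip: poly_mult map_poly_of_nat_mult)

lemma N_qinv_of_nat: "of_nat n \<in> N_qinv"
  unfolding N_qinv_def by (rule range_eqI[of _ _ "[:n:]"]) (simp add: map_poly_pCons)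

lemma N_qinv_0: "0 \<in> N_qinv" and N_qinv_1: "1 \<in> N_qinv"
  using N_qinv_of_nat[of 0] N_qinv_of_nat[of 1] by simp_all

lemma N_qinv_inverse_q: "inverse q \<in> N_qinv"
  unfolding N_qinv_def by (rule range_eqI[of _ _ "[:0, 1:]"]) (simp add: map_poly_pCons)

lemma N_qinv_power: "a \<in> N_qinv \<Longrightarrow> a ^ n \<in> N_qinv"
  by (induction n) (auto intro: N_qinv_1 N_qinv_mult)

lemma N_qinv_subset_Z_qinv: "N_qinv \<subseteq> Z_qinv"
proof
  fix a assume "a \<in> N_qinv"
  then obtain f :: "nat poly" where "a = poly (map_poly of_nat f) (inverse q)"
    unfolding N_qinv_def by auto
  moreover have "(map_poly of_nat f :: ratq poly) = map_poly of_int (map_poly int f)"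
    by (rule poly_eqI) (simp add: coeff_map_poly)
  ultimately show "a \<in> Z_qinv" unfolding Z_qinv_def by auto
qed

lemma Z_qinv_0: "0 \<in> Z_qinv" and Z_qinv_1: "1 \<in> Z_qinv"
  using N_qinv_0 N_qinv_1 N_qinv_subset_Z_qinv by auto

lemma Z_qinv_uminus:
  assumes "a \<in> Z_qinv" shows "- a \<in> Z_qinv"
proof -
  have "-1 \<in> Z_qinv"
    unfolding Z_qinv_def by (rule range_eqI[of _ _ "[:-1:]"]) (simp add: map_poly_pCons)
  then show ?thesis using Z_qinv_mult[of "-1" a] assms by simp
qed

lemma Z_qinv_diff: "a \<in> Z_qinv \<Longrightarrow> b \<in> Z_qinv \<Longrightarrow> a - b \<in> Z_qinv"
  using Z_qinv_add[of a "- b"] Z_qinv_uminus[of b] by simp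

lemma Z_qinv_sum: "(\<And>x. x \<in> A \<Longrightarrow> f x \<in> Z_qinv) \<Longrightarrow> sum f A \<in> Z_qinv"
  by (induction A rule: infinite_finite_induct) (auto intro: Z_qinv_0 Z_qinv_add)

lemma gauss_binom_N_qinv: "gauss_binom (inverse q) n k \<in> N_qinv"
  by (induction "inverse q" n k rule: gauss_binom.induct)
    (auto intro!: N_qinv_1 N_qinv_0 N_qinv_add N_qinv_mult N_qinv_power N_qinv_inverse_q)

lemma binom_prod_coeff_N_qinv: "binom_prod_coeff (inverse q) i j b \<in> N_qinv"
  unfolding binom_prod_coeff_def
  by (intro N_qinv_mult N_qinv_power N_qinv_inverse_q gauss_binom_N_qinv)

section \<open>The polynomials \<open>bar (qbinom k)\<close>\<close>

text \<open>
  That \<open>q\<close> is not a root of unity makes all \<open>q\<close>-integers with positive index invertible, both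
  for \<open>q\<close> and for \<open>q\<^sup>-\<^sup>1\<close>.
\<close>

lemma q_power_neq_1: "n > 0 \<Longrightarrow> q ^ n \<noteq> 1"
proof
  assume n: "n > 0" and 1: "q ^ n = 1"
  have "q ^ n = to_fract ([:0, 1:] ^ n)"
    by (induction n) (simp_all only: power_0 power_Suc q_def to_fract_mult to_fract_1)
  then have "[:0, 1::rat:] ^ n = 1" using 1 by (metis to_fract_1 to_fract_eq_iff)
  then have "degree ([:0, 1::rat:] ^ n) = 0" by simp
  then show False using n by (simp add: degree_power_eq)
qed

lemma q_neq_1: "q \<noteq> 1"
  using q_power_neq_1[of 1] by simp

lemma qint_of_nat: "qint (int n) = qnum q n"
  using qnum_geometric[of q n] q_neq_1 by (simp add: qint_def field_simps)

text \<open>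
  Reversing the order of the summands \<open>1, q, \<dots>, q\<^sup>n\<close> and extracting \<open>q\<^sup>n\<close>.
\<close>

lemma qnum_q_Suc: "qnum q (Suc n) = q ^ n * qnum (inverse q) (Suc n)"
proof (induction n)
  case 0
  then show ?case by (simp add: qnum_Suc)
next
  case (Suc n)
  have unit: "q ^ Suc n * inverse q ^ Suc n = 1"
    by (metis power_mult_distrib right_inverse q_nonzero power_one)
  have "qnum q (Suc (Suc n)) = 1 + q * (q ^ n * qnum (inverse q) (Suc n))"
    by (simp only: qnum_Suc_shift[of q "Suc n"] Suc)
  also have "\<dots> = q ^ Suc n * (qnum (inverse q) (Suc n) + inverse q ^ Suc n)"
    by (simp only: distrib_left unit) (simp add: mult_ac)
  finally show ?case by (simp only: qnum_Suc)
qed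

lemma qnum_q_neq_0: "qnum q (Suc n) \<noteq> 0"
  using qnum_geometric[of q "Suc n"] q_power_neq_1[of "Suc n"] by force

lemma qnum_inverse_q_neq_0: "qnum (inverse q) (Suc n) \<noteq> 0"
  using qnum_q_neq_0[of n] qnum_q_Suc[of n] by auto

lemma qnum_fact_inverse_q_neq_0: "qnum_fact (inverse q) n \<noteq> 0"
  by (induction n) (auto simp: qnum_fact_Suc qnum_inverse_q_neq_0)

lemma qfact_Suc: "qfact (Suc n) = qnum q (Suc n) * qfact n"
  by (simp add: qfact_def mult.commute qint_of_nat del: of_nat_Suc)

lemma Suc_choose_2: "Suc n choose 2 = (n choose 2) + n"
  by (simp add: numeral_2_eq_2)

lemma qfact_eq: "qfact n = q ^ (n choose 2) * qnum_fact (inverse q) n"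
proof (induction n)
  case 0
  then show ?case by (simp add: qfact_def numeral_2_eq_2)
next
  case (Suc n)
  show ?case
    unfolding Suc_choose_2
    by (simp add: qfact_Suc Suc qnum_fact_Suc qnum_q_Suc power_add)
qed

lemma qbinom_0: "qbinom 0 = 1"
  by (simp add: qbinom_def qfact_def numeral_2_eq_2 one_pCons)

lemma qbinom_Suc:
  "[:- qnum q k, 1:] * qbinom k = Polynomial.smult (q ^ k * qnum q (Suc k)) (qbinom (Suc k))"
  unfolding qbinom_def Suc_choose_2
  by (simp add: qint_of_nat qfact_Suc qnum_q_neq_0 power_add mult.commute field_simps)

lemma bar_coeff_power: "bar_coeff (a ^ n) = bar_coeff a ^ n"
  by (induction n) (simp_all add: bar_coeff_1 bar_coeff_mult)

lemma bar_coeff_qnum: "bar_coeff (qnum q n) = qnum (inverse q) n"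
  by (induction n) (simp_all add: qnum_Suc bar_coeff_0 bar_coeff_add bar_coeff_power bar_coeff_q)

lemma bar_smult: "bar (Polynomial.smult c P) = Polynomial.smult (bar_coeff c) (bar P)"
proof -
  have "bar (Polynomial.smult c P) = bar ([:c:] * P)" by simp
  also have "\<dots> = Polynomial.smult (bar_coeff c) (bar P)" by (simp only: bar_mult bar_const) simp
  finally show ?thesis .
qed

lemma sum_smult: "(\<Sum>x\<in>A. Polynomial.smult c (f x)) = Polynomial.smult c (sum f A)"
  by (induction A rule: infinite_finite_induct) (simp_all add: smult_add_right)

lemma bar_linear: "bar [:a, 1:] = [:bar_coeff a, - q:]"
proof -
  have "bar [:a, 1:] = bar ([:a:] + [:0, 1:])" by simp
  also have "\<dots> = [:bar_coeff a, - q:]" by (simp only: bar_add bar_const bar_x) simp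
  finally show ?thesis .
qed

abbreviation barbinom :: "nat \<Rightarrow> ratq poly" where
  "barbinom k \<equiv> bar (qbinom k)"

lemma barbinom_0: "barbinom 0 = 1"
  by (simp add: qbinom_0 bar_1)

text \<open>
  The bar image of the recursion \<open>qbinom_Suc\<close>. Together with \<open>\<beta> 0 = 1\<close> it determines the
  \<open>\<beta> k\<close>, and their values, products and span are computed from it.
\<close>

lemma barbinom_Suc:
  "[:- qnum (inverse q) k, - q:] * barbinom k
    = Polynomial.smult (inverse q ^ k * qnum (inverse q) (Suc k)) (barbinom (Suc k))"
  using arg_cong[OF qbinom_Suc[of k], of bar]
  by (simp only: bar_mult bar_linear bar_smult bar_coeff_mult bar_coeff_power bar_coeff_qnum
      bar_coeff_q bar_coeff_uminus)

text \<open>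
  The evaluation points \<open>[-n]\<^sub>q\<close> of \<^const>\<open>Rq_minus\<close> are exactly those at which the linear
  polynomial \<open>- q x\<close> takes the values \<open>[n]\<^sub>p\<close>.
\<close>

lemma qint_minus: "- q * qint (- int n) = qnum (inverse q) n"
proof -
  have "qint (- int n) = (inverse q ^ n - 1) / (q - 1)"
    by (simp add: qint_def power_int_minus power_inverse)
  also have "\<dots> = (inverse q - 1) * qnum (inverse q) n / (q - 1)"
    by (simp only: qnum_geometric)
  also have "- q * \<dots> = qnum (inverse q) n"
    using q_neq_1 by (simp add: divide_simps) (simp add: algebra_simps)
  finally show ?thesis .
qed

text \<open>
  Both sides satisfy the same recursion in \<open>k\<close>: compare \<open>barbinom_Suc\<close>, evaluated by means of
  \<open>qint_minus\<close>, with \<open>gauss_binom_ratio\<close>.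
\<close>

lemma poly_barbinom: "poly (barbinom k) (qint (- int n)) = gauss_binom (inverse q) n k"
proof (induction k)
  case 0
  then show ?case by (simp add: barbinom_0)
next
  case (Suc k)
  let ?p = "inverse q"
  let ?y = "qint (- int n)"
  let ?c = "?p ^ k * qnum ?p (Suc k)"
  have "?c * poly (barbinom (Suc k)) ?y = poly ([:- qnum ?p k, - q:] * barbinom k) ?y"
    by (simp only: barbinom_Suc poly_smult)
  also have "\<dots> = (- q * ?y - qnum ?p k) * poly (barbinom k) ?y"
    by (simp add: algebra_simps)
  also have "\<dots> = ?c * gauss_binom ?p n (Suc k)"
    by (simp only: qint_minus Suc gauss_binom_ratio)
  finally show ?case by (simp add: qnum_inverse_q_neq_0)
qed

section \<open>The product formula\<close>

lemma barbinom_mult: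
  "barbinom i * barbinom j
    = (\<Sum>b\<le>i. Polynomial.smult (binom_prod_coeff (inverse q) i j b) (barbinom (j + b)))"
proof (induction i)
  case 0
  then show ?case by (simp add: barbinom_0 binom_prod_coeff_def)
next
  case (Suc i)
  define p where "p = inverse q"
  define d where "d = binom_prod_coeff p"
  define X where "X b = Polynomial.smult (d i j b * (qnum p (j + b) - qnum p i)) (barbinom (j + b))"
    for b
  define Y where "Y b = Polynomial.smult (d i j b * (p ^ (j + b) * qnum p (Suc (j + b))))
    (barbinom (Suc (j + b)))" for b
  define c where "c = p ^ i * qnum p (Suc i)"
  \<comment> \<open>\<open>c\<close> is the factor in front of \<open>\<beta> (i+1)\<close> in the recursion; it is cancelled at the end.\<close>
  have c: "c \<noteq> 0" by (simp add: c_def p_def qnum_inverse_q_neq_0)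
  have step: "[:- qnum p i, - q:] * Polynomial.smult (d i j b) (barbinom (j + b)) = Y b + X b" for b
  proof -
    have "[:- qnum p i, - q:]
        = [:- qnum p (j + b), - q:] + [:qnum p (j + b) - qnum p i:]"
      by simp
    then have "[:- qnum p i, - q:] * barbinom (j + b)
        = Polynomial.smult (p ^ (j + b) * qnum p (Suc (j + b))) (barbinom (Suc (j + b)))
          + Polynomial.smult (qnum p (j + b) - qnum p i) (barbinom (j + b))"
      by (simp only: distrib_right p_def barbinom_Suc) simp
    then show ?thesis
      by (simp only: mult_smult_right smult_add_right smult_smult X_def Y_def)
  qed
  \<comment> \<open>This lets the sum of the \<open>X b\<close> run to \<open>Suc i\<close>, as the shifted sum of the \<open>Y b\<close> does.\<close>
  have X_last: "X (Suc i) = 0"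
    by (simp add: X_def d_def binom_prod_coeff_def gauss_binom_eq_0)
  have "Polynomial.smult c (barbinom (Suc i) * barbinom j)
      = [:- qnum p i, - q:] * barbinom i * barbinom j"
    by (simp only: c_def p_def barbinom_Suc mult_smult_left)
  also have "\<dots> = (\<Sum>b\<le>i. [:- qnum p i, - q:] * Polynomial.smult (d i j b) (barbinom (j + b)))"
    by (simp only: mult.assoc Suc d_def p_def sum_distrib_left)
  also have "\<dots> = (\<Sum>b\<le>i. Y b) + (\<Sum>b\<le>Suc i. X b)"
    by (simp only: step sum.distrib) (simp add: X_last)
  also have "\<dots> = X 0 + (\<Sum>b\<le>i. Y b + X (Suc b))"
    by (simp only: sum.atMost_Suc_shift sum.distrib add_ac)
  also have "\<dots> = (\<Sum>b\<le>Suc i. Polynomial.smult (c * d (Suc i) j b) (barbinom (j + b)))"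
  proof -
    have "Polynomial.smult (c * d (Suc i) j 0) (barbinom (j + 0)) = X 0"
      by (simp only: X_def c_def d_def binom_prod_coeff_Suc_0 add_0_right)
    moreover have "Polynomial.smult (c * d (Suc i) j (Suc b)) (barbinom (j + Suc b))
        = Y b + X (Suc b)" for b
      by (simp only: X_def Y_def c_def d_def binom_prod_coeff_Suc_Suc smult_add_left add_Suc_right)
    ultimately show ?thesis by (simp only: sum.atMost_Suc_shift)
  qed
  also have "\<dots> = Polynomial.smult c
      (\<Sum>b\<le>Suc i. Polynomial.smult (d (Suc i) j b) (barbinom (j + b)))"
    by (simp only: sum_smult flip: smult_smult)
  finally show ?case using c by (simp only: smult_cancel d_def p_def)
qed

lemma choose_2_add3:
  "(a + b + c) choose 2 = (a choose 2) + (b choose 2) + (c choose 2) + (a * b + a * c + b * c)"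
proof -
  have 2: "(m + n) choose 2 = (m choose 2) + (n choose 2) + m * n" for m n :: nat
    by (induction n) (simp_all add: Suc_choose_2)
  show ?thesis by (simp add: 2 algebra_simps)
qed

text \<open>
  The factorials contribute \<open>q\<close> to the power
  \<open>(a+b+c over 2) - (a over 2) - (b over 2) - (c over 2) = ab + ac + bc\<close>, so that of the
  exponent \<open>- (2ab + ac + bc)\<close> just \<open>- ab\<close> is left.
\<close>

lemma q_multinomial:
  "q powi (- int (2 * a * b + a * c + b * c)) * qfact (a + b + c) / (qfact a * qfact b * qfact c)
    = inverse q ^ (a * b)
      * (qnum_fact (inverse q) (a + b + c)
        / (qnum_fact (inverse q) a * qnum_fact (inverse q) b * qnum_fact (inverse q) c))"
proof -
  let ?f = "qnum_fact (inverse q)"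
  let ?Q = "q ^ (a choose 2) * q ^ (b choose 2) * q ^ (c choose 2)"
  have cancel: "inverse q ^ (s + t) * q ^ (r + t) = inverse q ^ s * q ^ r" for r s t
    by (simp add: power_add power_inverse)
  have "q powi (- int (2 * a * b + a * c + b * c)) = inverse q ^ (a * b + (a * b + a * c + b * c))"
    by (simp only: power_int_minus power_int_of_nat power_inverse mult_2 distrib_right add.assoc)
  then have "q powi (- int (2 * a * b + a * c + b * c)) * qfact (a + b + c)
      = inverse q ^ (a * b) * ?Q * ?f (a + b + c)"
    by (simp only: qfact_eq choose_2_add3 mult.assoc[symmetric] cancel) (simp only: power_add mult.assoc)
  moreover have "qfact a * qfact b * qfact c = ?Q * (?f a * ?f b * ?f c)"
    by (simp only: qfact_eq mult_ac)
  moreover have "?Q \<noteq> 0" by simp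
  ultimately show ?thesis by simp
qed

text \<open>
  With \<open>a = k - i\<close>, \<open>b = k - j\<close> and \<open>c = i + j - k\<close> one has \<open>k = a + b + c\<close>, \<open>i = b + c\<close> and
  \<open>j = a + c\<close>; the two Gaussian coefficients multiply to the \<open>p\<close>-multinomial coefficient of
  \<open>(a, b, c)\<close>.
\<close>

lemma binom_prod_coeff_eq:
  assumes "max i j \<le> k" "k \<le> i + j"
  shows "binom_prod_coeff (inverse q) i j (k - j)
    = q powi (int i * (int i - int k) + int j * (int j - int k)) * qfact k
        / (qfact (k - i) * qfact (k - j) * qfact (i + j - k))"
proof -
  define a b c where "a = k - i" and "b = k - j" and "c = i + j - k"
  have ij: "i = b + c" "j = a + c" "k = a + b + c"
    using assms by (auto simp: a_def b_def c_def)
  let ?p = "inverse q"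
  let ?f = "qnum_fact ?p"
  have k: "gauss_binom ?p k i * ?f i * ?f a = ?f k"
    using gauss_binom_fact[of ?p "b + c" a] by (simp only: ij add_ac)
  have i: "gauss_binom ?p i b * ?f b * ?f c = ?f i"
    using gauss_binom_fact[of ?p b c] by (simp only: ij)
  have "gauss_binom ?p k i * gauss_binom ?p i b * (?f a * ?f b * ?f c)
      = gauss_binom ?p k i * (gauss_binom ?p i b * ?f b * ?f c) * ?f a"
    by (simp only: mult_ac)
  also have "\<dots> = ?f k" by (simp only: i k)
  finally have "gauss_binom ?p k i * gauss_binom ?p i b = ?f k / (?f a * ?f b * ?f c)"
    by (simp add: nonzero_eq_divide_eq qnum_fact_inverse_q_neq_0)
  moreover have "binom_prod_coeff ?p i j b = ?p ^ (a * b) * (gauss_binom ?p k i * gauss_binom ?p i b)"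
    by (simp add: binom_prod_coeff_def ij add_ac)
  moreover have "int i * (int i - int k) + int j * (int j - int k) = - int (2 * a * b + a * c + b * c)"
    by (simp add: ij algebra_simps)
  ultimately show ?thesis
    using q_multinomial[of a b c]
    by (simp only: a_def[symmetric] b_def[symmetric] c_def[symmetric] ij(3)[symmetric])
qed

lemma barbinom_mult_sum:
  "barbinom i * barbinom j
    = (\<Sum>k = max i j..i + j. Polynomial.smult (binom_prod_coeff (inverse q) i j (k - j)) (barbinom k))"
proof -
  let ?g = "\<lambda>k. Polynomial.smult (binom_prod_coeff (inverse q) i j (k - j)) (barbinom k)"
  have "barbinom i * barbinom j = (\<Sum>b\<le>i. ?g (j + b))"
    by (simp add: barbinom_mult)
  also have "\<dots> = (\<Sum>k = j..j + i. ?g k)"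
    using sum.shift_bounds_cl_nat_ivl[of ?g 0 j i] by (simp add: add.commute atMost_atLeast0)
  also have "\<dots> = (\<Sum>k = max i j..i + j. ?g k)"
    by (rule sum.mono_neutral_right) (auto simp: binom_prod_coeff_def gauss_binom_eq_0)
  finally show ?thesis .
qed

section \<open>Free generation\<close>

text \<open>
  The span of the \<open>\<beta> k\<close> over \<open>\<rat>(q)\<close> contains \<open>\<beta> 0 = 1\<close> and is stable under multiplication
  by \<open>x\<close>, since \<open>- q x \<beta> k = [k]\<^sub>p \<beta> k + p\<^sup>k [k+1]\<^sub>p \<beta> (k+1)\<close>.
\<close>

lemma poly_eq_sum_barbinom: "\<exists>N c. P = (\<Sum>k<N. Polynomial.smult (c k) (barbinom k))"
proof (induction P)
  case 0
  show ?case by (rule exI[of _ 0]) simp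
next
  case (pCons a P)
  then obtain N c where P: "P = (\<Sum>k<N. Polynomial.smult (c k) (barbinom k))" by blast
  let ?p = "inverse q"
  \<comment> \<open>\<open>u k\<close> and \<open>v k\<close> are the contributions of \<open>x c\<^sub>k \<beta> k\<close> to the coordinates \<open>k\<close> and \<open>k + 1\<close>;
    \<open>u\<close> is cut off at \<open>N\<close> because the new range of summation is one longer.\<close>
  define u where "u k = (if k < N then - ?p * (c k * qnum ?p k) else 0)" for k
  define v where "v k = - ?p * (c k * (?p ^ k * qnum ?p (Suc k)))" for k
  define w where "w k = u k + (case k of 0 \<Rightarrow> a | Suc l \<Rightarrow> v l)" for k
  have x: "[:0, 1:] * Polynomial.smult (c k) (barbinom k)
      = Polynomial.smult (u k) (barbinom k) + Polynomial.smult (v k) (barbinom (Suc k))"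
    if "k < N" for k
  proof -
    have "[:0, 1:] = Polynomial.smult (- ?p) ([:- qnum ?p k, - q:] + [:qnum ?p k:])" by simp
    then have "[:0, 1:] * barbinom k = Polynomial.smult (- ?p)
        (Polynomial.smult (?p ^ k * qnum ?p (Suc k)) (barbinom (Suc k))
          + Polynomial.smult (qnum ?p k) (barbinom k))"
      by (simp only: distrib_right mult_smult_left barbinom_Suc) simp
    then show ?thesis using that
      by (simp add: mult_smult_right smult_add_right smult_diff_right u_def v_def mult_ac)
  qed
  have "pCons a P = Polynomial.smult a (barbinom 0) + [:0, 1:] * P"
    by (simp add: barbinom_0)
  also have "[:0, 1:] * P = (\<Sum>k<N. Polynomial.smult (u k) (barbinom k))
      + (\<Sum>k<N. Polynomial.smult (v k) (barbinom (Suc k)))"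
    unfolding P sum_distrib_left sum.distrib[symmetric] by (rule sum.cong[OF refl]) (simp only: lessThan_iff x)
  also have "(\<Sum>k<N. Polynomial.smult (u k) (barbinom k))
      = (\<Sum>k<Suc N. Polynomial.smult (u k) (barbinom k))"
    by (simp add: u_def)
  also have "Polynomial.smult a (barbinom 0)
      + (\<dots> + (\<Sum>k<N. Polynomial.smult (v k) (barbinom (Suc k))))
    = (\<Sum>k<Suc N. Polynomial.smult (w k) (barbinom k))"
    by (simp add: sum.lessThan_Suc_shift w_def smult_add_left sum.distrib add_ac
        del: sum.lessThan_Suc)
  finally show ?case by blast
qed

text \<open>
  At \<open>[-n]\<^sub>q\<close> the summands with \<open>k > n\<close> vanish and \<open>\<beta> n\<close> has value \<open>1\<close>, so the value of \<open>P\<close>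
  there determines the \<open>n\<close>-th coordinate from the earlier ones by subtraction alone. This gives
  uniqueness of the coordinates as well as their integrality.
\<close>

lemma coeff_eq_triangular:
  assumes P: "P = (\<Sum>k\<in>A. Polynomial.smult (c k) (barbinom k))"
    and A: "finite A" "\<And>k. k \<notin> A \<Longrightarrow> c k = 0"
  shows "c n = poly P (qint (- int n)) - (\<Sum>k<n. c k * gauss_binom (inverse q) n k)"
proof -
  let ?f = "\<lambda>k. c k * gauss_binom (inverse q) n k"
  have "poly P (qint (- int n)) = (\<Sum>k\<in>A. ?f k)"
    by (simp add: P poly_sum poly_barbinom)
  also have "\<dots> = (\<Sum>k\<in>A \<inter> {..n}. ?f k)"
    by (rule sum.mono_neutral_right) (use A in \<open>auto intro: leI gauss_binom_eq_0\<close>)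
  also have "\<dots> = (\<Sum>k\<le>n. ?f k)"
    by (rule sum.mono_neutral_left) (use A in auto)
  also have "\<dots> = (\<Sum>k<n. ?f k) + c n"
    by (simp add: gauss_binom_self flip: lessThan_Suc_atMost)
  finally show ?thesis by simp
qed

lemma cring_Z_qinv_ring: "cring Z_qinv_ring"
proof (rule cringI)
  show "abelian_group Z_qinv_ring"
    by (rule abelian_groupI)
      (auto simp: Z_qinv_ring_def Z_qinv_add Z_qinv_0 algebra_simps
        intro: bexI[OF _ Z_qinv_uminus])
  show "comm_monoid Z_qinv_ring"
    by (rule comm_monoidI) (auto simp: Z_qinv_ring_def Z_qinv_mult Z_qinv_1)
qed (simp add: Z_qinv_ring_def distrib_right)

lemma cring_Rq_minus_algebra: "cring Rq_minus_algebra"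
proof (rule cringI)
  have closed: "P + Q \<in> Rq_minus" "P * Q \<in> Rq_minus"
    if "P \<in> Rq_minus" "Q \<in> Rq_minus" for P Q
    using that by (simp_all add: Rq_minus_def Z_qinv_add Z_qinv_mult)
  have const: "0 \<in> Rq_minus" "1 \<in> Rq_minus"
    by (simp_all add: Rq_minus_def Z_qinv_0 Z_qinv_1)
  have neg: "\<exists>Q\<in>Rq_minus. Q + P = 0" if "P \<in> Rq_minus" for P
    using that by (intro bexI[of _ "- P"]) (simp_all add: Rq_minus_def Z_qinv_uminus)
  show "abelian_group Rq_minus_algebra"
    by (rule abelian_groupI)
      (auto simp: Rq_minus_algebra_def closed const add.assoc intro: neg add.commute)
  show "comm_monoid Rq_minus_algebra"
    by (rule comm_monoidI) (auto simp: Rq_minus_algebra_def closed const mult.assoc intro: mult.commute)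
qed (simp add: Rq_minus_algebra_def distrib_right)

lemma algebra_Rq_minus: "algebra Z_qinv_ring Rq_minus_algebra"
proof -
  interpret R: cring Z_qinv_ring by (rule cring_Z_qinv_ring)
  interpret M: cring Rq_minus_algebra by (rule cring_Rq_minus_algebra)
  show ?thesis
    by unfold_locales
      (auto simp: Z_qinv_ring_def Rq_minus_algebra_def Rq_minus_def Z_qinv_mult
        smult_add_left smult_add_right)
qed

lemma barbinom_in_Rq_minus: "barbinom k \<in> Rq_minus"
  using gauss_binom_N_qinv N_qinv_subset_Z_qinv by (auto simp: Rq_minus_def poly_barbinom)

lemma finsum_Rq_minus:
  assumes "finite A" "f ` A \<subseteq> Rq_minus"
  shows "finsum Rq_minus_algebra f A = sum f A"
  using assms
proof (induction A)
  interpret cring Rq_minus_algebra by (rule cring_Rq_minus_algebra)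
  case empty
  show ?case unfolding finsum_empty by (simp add: Rq_minus_algebra_def)
next
  interpret cring Rq_minus_algebra by (rule cring_Rq_minus_algebra)
  case (insert a A)
  have "carrier Rq_minus_algebra = Rq_minus" by (simp add: Rq_minus_algebra_def)
  with insert have "finsum Rq_minus_algebra f (insert a A)
      = f a \<oplus>\<^bsub>Rq_minus_algebra\<^esub> finsum Rq_minus_algebra f A"
    by (intro finsum_insert) auto
  with insert show ?case by (simp add: Rq_minus_algebra_def)
qed

lemma is_expansion_iff:
  "is_expansion Z_qinv_ring Rq_minus_algebra barbinom P c \<longleftrightarrow>
    range c \<subseteq> Z_qinv \<and> finite {k. c k \<noteq> 0} \<and>
    P = (\<Sum>k | c k \<noteq> 0. Polynomial.smult (c k) (barbinom k))"
proof -
  have "finsum Rq_minus_algebra (\<lambda>k. Polynomial.smult (c k) (barbinom k)) {k. c k \<noteq> 0}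
      = (\<Sum>k | c k \<noteq> 0. Polynomial.smult (c k) (barbinom k))"
    if "range c \<subseteq> Z_qinv" "finite {k. c k \<noteq> 0}"
    using that barbinom_in_Rq_minus
    by (intro finsum_Rq_minus) (auto simp: Rq_minus_def image_subset_iff intro!: Z_qinv_mult)
  moreover have "(\<odot>\<^bsub>Rq_minus_algebra\<^esub>) = Polynomial.smult"
    by (simp add: Rq_minus_algebra_def)
  ultimately show ?thesis by (auto simp: is_expansion_def Z_qinv_ring_def)
qed

text \<open>
  Coordinates are naturally given on an index set that may contain indices with coefficient
  \<open>0\<close>, whereas \<^const>\<open>is_expansion\<close> sums over the exact support.
\<close>

lemma is_expansionI:
  assumes "range c \<subseteq> Z_qinv" "finite A" "\<And>k. k \<notin> A \<Longrightarrow> c k = 0"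
    and "P = (\<Sum>k\<in>A. Polynomial.smult (c k) (barbinom k))"
  shows "is_expansion Z_qinv_ring Rq_minus_algebra barbinom P c"
proof -
  have "{k. c k \<noteq> 0} \<subseteq> A" using assms(3) by auto
  moreover from this have "(\<Sum>k\<in>A. Polynomial.smult (c k) (barbinom k))
      = (\<Sum>k | c k \<noteq> 0. Polynomial.smult (c k) (barbinom k))"
    using assms(2) by (intro sum.mono_neutral_right) auto
  ultimately show ?thesis
    using assms finite_subset by (auto simp: is_expansion_iff)
qed

lemma is_expansion_unique:
  assumes "is_expansion Z_qinv_ring Rq_minus_algebra barbinom P c"
    and "is_expansion Z_qinv_ring Rq_minus_algebra barbinom P d"
  shows "c = d"
proof
  fix n
  show "c n = d n"
  proof (induction n rule: less_induct)
    case (less n)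
    have *: "e n = poly P (qint (- int n)) - (\<Sum>k<n. e k * gauss_binom (inverse q) n k)"
      if "is_expansion Z_qinv_ring Rq_minus_algebra barbinom P e" for e
      using that by (intro coeff_eq_triangular[where A = "{k. e k \<noteq> 0}"]) (auto simp: is_expansion_iff)
    show ?case using less by (simp add: *[OF assms(1)] *[OF assms(2)])
  qed
qed

lemma is_expansion_exists:
  assumes "P \<in> Rq_minus"
  shows "\<exists>c. is_expansion Z_qinv_ring Rq_minus_algebra barbinom P c"
proof -
  obtain N c where P: "P = (\<Sum>k<N. Polynomial.smult (c k) (barbinom k))"
    using poly_eq_sum_barbinom by blast
  \<comment> \<open>Outside the range of summation \<open>c\<close> is arbitrary, but an expansion has finite support.\<close>
  define d where "d k = (if k < N then c k else 0)" for k
  have P': "P = (\<Sum>k<N. Polynomial.smult (d k) (barbinom k))"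
    by (simp add: P d_def)
  have "d n \<in> Z_qinv" for n
  proof (induction n rule: less_induct)
    case (less n)
    have "d n = poly P (qint (- int n)) - (\<Sum>k<n. d k * gauss_binom (inverse q) n k)"
      by (rule coeff_eq_triangular[OF P']) (auto simp: d_def)
    moreover have "poly P (qint (- int n)) \<in> Z_qinv" using assms by (simp add: Rq_minus_def)
    ultimately show ?case
      using less gauss_binom_N_qinv N_qinv_subset_Z_qinv
      by (auto intro!: Z_qinv_diff Z_qinv_sum Z_qinv_mult)
  qed
  then have "range d \<subseteq> Z_qinv" by auto
  then have "is_expansion Z_qinv_ring Rq_minus_algebra barbinom P d"
    by (rule is_expansionI[OF _ finite_lessThan _ P']) (simp add: d_def)
  then show ?thesis by blast
qed

lemma freely_generated_barbinom: "freely_generated Z_qinv_ring Rq_minus_algebra barbinom"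
  unfolding freely_generated_def
proof (intro conjI ballI)
  show "Module.module Z_qinv_ring Rq_minus_algebra"
    using algebra_Rq_minus by (rule algebra.axioms)
  show "range barbinom \<subseteq> carrier Rq_minus_algebra"
    using barbinom_in_Rq_minus by (auto simp: Rq_minus_algebra_def)
  fix P assume "P \<in> carrier Rq_minus_algebra"
  then have "P \<in> Rq_minus" by (simp add: Rq_minus_algebra_def)
  then show "\<exists>!c. is_expansion Z_qinv_ring Rq_minus_algebra barbinom P c"
    using is_expansion_exists is_expansion_unique by blast
qed

lemma structure_constant_N_qinv:
  "structure_constant Z_qinv_ring Rq_minus_algebra barbinom i j k \<in> N_qinv"
proof -
  define c where
    "c k = (if k \<in> {max i j..i + j} then binom_prod_coeff (inverse q) i j (k - j) else 0)" for k
  have N: "c k \<in> N_qinv" for k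
    by (simp add: c_def binom_prod_coeff_N_qinv N_qinv_0)
  have range_c: "range c \<subseteq> Z_qinv" using N N_qinv_subset_Z_qinv by auto
  have "barbinom i * barbinom j = (\<Sum>k = max i j..i + j. Polynomial.smult (c k) (barbinom k))"
    unfolding barbinom_mult_sum by (rule sum.cong[OF refl]) (simp add: c_def)
  then have "is_expansion Z_qinv_ring Rq_minus_algebra barbinom (barbinom i * barbinom j) c"
    by (rule is_expansionI[OF range_c finite_atLeastAtMost, rotated]) (auto simp: c_def)
  then have "(THE c. is_expansion Z_qinv_ring Rq_minus_algebra barbinom
      (barbinom i \<otimes>\<^bsub>Rq_minus_algebra\<^esub> barbinom j) c) = c"
    by (intro the_equality is_expansion_unique) (auto simp: Rq_minus_algebra_def)
  then show ?thesis by (simp add: structure_constant_def N)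
qed

theorem corollary6p2:
  shows "freely_generated Z_qinv_ring Rq_minus_algebra (\<lambda>k::nat. bar (qbinom k)) \<and>
    (\<forall>i j :: nat. bar (qbinom i) * bar (qbinom j) =
      (\<Sum>k = max i j..i + j.
        Polynomial.smult
          (q powi (int i * (int i - int k) + int j * (int j - int k)) * qfact k
            / (qfact (k - i) * qfact (k - j) * qfact (i + j - k)))
          (bar (qbinom k)))) \<and>
    algebra Z_qinv_ring Rq_minus_algebra \<and>
    (\<forall>i j k :: nat.
      structure_constant Z_qinv_ring Rq_minus_algebra (\<lambda>k. bar (qbinom k)) i j k \<in> N_qinv)"
proof (intro conjI allI)
  fix i j :: nat
  show "bar (qbinom i) * bar (qbinom j) =
      (\<Sum>k = max i j..i + j.
        Polynomial.smult
          (q powi (int i * (int i - int k) + int j * (int j - int k)) * qfact k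
            / (qfact (k - i) * qfact (k - j) * qfact (i + j - k)))
          (bar (qbinom k)))"
    unfolding barbinom_mult_sum
    by (rule sum.cong[OF refl]) (simp only: binom_prod_coeff_eq atLeastAtMost_iff)
qed (rule freely_generated_barbinom algebra_Rq_minus structure_constant_N_qinv)+

end
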